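(* Let $G$ be a finite simple graph and $T$ its toll walk transit function. Then $T$ satisfies Axioms (dh) and (dh1) on $G$ if and only if $G$ is a distance-hereditary graph.
   Context: In a finite simple graph $G$, a walk $W=w_1w_2\cdots w_k$ ($k\ge 2$) is a toll walk if $w_1\neq w_k$, $w_2$ is the only neighbor of $w_1$ among the vertices of $W$, and $w_{k-1}$ is the only neighbor of $w_k$ among the vertices of $W$. The toll walk transit function $T$ of $G$ is given by $T(u,u)=\{u\}$ and, for $u\ne v$, $T(u,v)$ is the set of all vertices lying on some toll walk from $u$ to $v$. A graph is distance-hereditary if every induced path is a shortest path. Axioms for $R=T$ on $V=V(G)$: (dh) For pairwise distinct $u,x,y,v,z$: if $x,y,z\in R(u,y)\cap R(x,v)$, $R(u,v)\neq\{u,v\}$, $R(x,y)=\{x,y\}$, $R(u,z)=\{u,z\}$ and $R(v,z)=\{v,z\}$, then $R(x,z)\neq\{x,z\}$ or $R(y,z)\neq\{y,z\}$. (dh1) For all $u,x,y,v$: if $x\in R(u,y)$, $y\in R(x,v)$, $R(x,y)=\{x,y\}$, $x\neq y$, $R(u,x)\neq\{u,x\}$ and $R(y,v)\neq\{y,v\}$, then $x\in R(u,v)$. *)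

theory Defs
  imports "Graph_Theory.Graph_Theory"
begin

text \<open>
  A finite simple graph is a digraph \<open>G\<close> with \<open>graph G\<close>: finite, symmetric, without loops and
  without parallel arcs. Walks and paths are non-empty vertex lists.
\<close>

text \<open>
  The second vertex of a toll walk is the only \<^emph>\<open>vertex\<close> of the walk adjacent to its first vertex;
  it may occur at several positions. The same holds for the vertex before the last one.
\<close>

definition toll_walk :: "('a, 'b) pre_digraph \<Rightarrow> 'a vwalk \<Rightarrow> bool" where
  "toll_walk G W \<longleftrightarrow>
     vwalk W G \<and> 2 \<le> length W \<and> hd W \<noteq> last W \<and>
     (\<forall>a\<in>set W. hd W \<rightarrow>\<^bsub>G\<^esub> a \<longleftrightarrow> a = W ! 1) \<and>
     (\<forall>a\<in>set W. last W \<rightarrow>\<^bsub>G\<^esub> a \<longleftrightarrow> a = W ! (length W - 2))"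

definition toll_transit :: "('a, 'b) pre_digraph \<Rightarrow> 'a \<Rightarrow> 'a \<Rightarrow> 'a set" where
  "toll_transit G u v =
     (if u = v then {u}
      else {w. \<exists>W. toll_walk G W \<and> hd W = u \<and> last W = v \<and> w \<in> set W})"

definition induced_path :: "('a, 'b) pre_digraph \<Rightarrow> 'a vwalk \<Rightarrow> bool" where
  "induced_path G p \<longleftrightarrow>
     vpath p G \<and>
     (\<forall>i<length p. \<forall>j<length p. p ! i \<rightarrow>\<^bsub>G\<^esub> p ! j \<longrightarrow> j = Suc i \<or> i = Suc j)"

definition shortest_path :: "('a, 'b) pre_digraph \<Rightarrow> 'a vwalk \<Rightarrow> bool" where
  "shortest_path G p \<longleftrightarrow>
     vpath p G \<and>
     (\<forall>q. vpath q G \<and> hd q = hd p \<and> last q = last p \<longrightarrow> vwalk_length p \<le> vwalk_length q)"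

definition distance_hereditary :: "('a, 'b) pre_digraph \<Rightarrow> bool" where
  "distance_hereditary G \<longleftrightarrow> (\<forall>p. induced_path G p \<longrightarrow> shortest_path G p)"

definition axiom_dh :: "'a set \<Rightarrow> ('a \<Rightarrow> 'a \<Rightarrow> 'a set) \<Rightarrow> bool" where
  "axiom_dh V R \<longleftrightarrow>
     (\<forall>u\<in>V. \<forall>x\<in>V. \<forall>y\<in>V. \<forall>v\<in>V. \<forall>z\<in>V.
        distinct [u, x, y, v, z] \<and>
        {x, y, z} \<subseteq> R u y \<inter> R x v \<and>
        R u v \<noteq> {u, v} \<and> R x y = {x, y} \<and> R u z = {u, z} \<and> R v z = {v, z}
        \<longrightarrow> R x z \<noteq> {x, z} \<or> R y z \<noteq> {y, z})"

definition axiom_dh1 :: "'a set \<Rightarrow> ('a \<Rightarrow> 'a \<Rightarrow> 'a set) \<Rightarrow> bool" where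
  "axiom_dh1 V R \<longleftrightarrow>
     (\<forall>u\<in>V. \<forall>x\<in>V. \<forall>y\<in>V. \<forall>v\<in>V.
        x \<in> R u y \<and> y \<in> R x v \<and> R x y = {x, y} \<and> x \<noteq> y \<and>
        R u x \<noteq> {u, x} \<and> R y v \<noteq> {y, v}
        \<longrightarrow> x \<in> R u v)"

end

theory Submission
  imports Defs
begin

text \<open>Two facts translate the axioms into graph terms. A toll interval is
  \<open>{u, v}\<close> exactly when \<open>u\<close> and \<open>v\<close> are equal or adjacent
  (\<open>toll_transit_eq_doubleton_iff\<close>), and an induced path between distinct vertices lies
  in the toll interval of its ends (\<open>induced_path_subset_toll_transit\<close>). Hence (dh)
  excludes the gem. Axiom (dh1) with both outer vertices equal to \<open>u\<close> excludes an edge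
  \<open>x y\<close> with induced paths \<open>y, x, ..., u\<close> and \<open>x, y, ..., u\<close>
  whose starts are not adjacent to \<open>u\<close>, because \<open>x\<close> would lie in
  \<open>T(u,u) = {u}\<close>.

  If the graph is distance-hereditary, induced paths with the same ends have equal length
  (\<open>distance_hereditary_length_eq\<close>), so that pair of paths is impossible, even as walks
  (\<open>distance_hereditary_no_two_walks\<close>). For (dh1), two toll walks sharing the edge
  \<open>x y\<close> are glued; impossibility of the pair keeps each end of the glued walk away from
  the other half (\<open>distance_hereditary_walks_apart\<close>). For (dh), a counterexample would
  be a gem, which has induced paths of different lengths between the same ends.

  Conversely, given the axioms, a minimal induced path that is not shortest is compared with a
  geodesic. Axiom (dh1) controls how the two leave their common start
  (\<open>axiom_dh1_shortcut\<close>), and every remaining configuration contains a gem, a house or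
  a path contradicting minimality.\<close>

unbundle no funcset_syntax

context graph
begin

section \<open>Walks and induced paths\<close>

lemma adj_commute: "a \<rightarrow> b \<longleftrightarrow> b \<rightarrow> a"
  using graph_symmetric by blast

lemma vwalk_Cons_iff:
  "vwalk (a # p) G \<longleftrightarrow> a \<in> verts G \<and> (p = [] \<or> a \<rightarrow> hd p \<and> vwalk p G)"
  by (cases p) (auto simp: vwalk_def)

lemma vwalk_Nil [simp]: "\<not> vwalk [] G"
  by (simp add: vwalk_def)

lemma vwalk_append_iff:
  "p \<noteq> [] \<Longrightarrow> q \<noteq> [] \<Longrightarrow>
    vwalk (p @ q) G \<longleftrightarrow> vwalk p G \<and> vwalk q G \<and> last p \<rightarrow> hd q"
  by (auto simp: vwalk_def vwalk_arcs_append)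

lemma vwalk_rev: "vwalk (rev p) G \<longleftrightarrow> vwalk p G"
proof -
  have *: "vwalk p G \<Longrightarrow> vwalk (rev p) G" for p
  proof (induction p)
    case (Cons a p)
    show ?case
    proof (cases "p = []")
      case False
      then show ?thesis
        using Cons
        by (auto simp: vwalk_Cons_iff vwalk_append_iff last_rev adj_commute)
    qed (use Cons in simp)
  qed simp
  from *[of p] *[of "rev p"] show ?thesis by auto
qed

lemma induced_path_Nil [simp]: "\<not> induced_path G []"
  by (simp add: induced_path_def vpath_def)

lemma induced_path_single [simp]: "induced_path G [a] \<longleftrightarrow> a \<in> verts G"
  using adj_not_same by (auto simp: induced_path_def vpath_def vwalk_Cons_iff)

text \<open>Replaces the condition on indices by a recursion on the list, so that simplification
  decides whether a concrete list is an induced path. That \<open>a\<close> and \<open>b\<close>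
  differ comes from the absence of loops.\<close>

lemma induced_path_Cons_Cons [simp]:
  "induced_path G (a # b # p) \<longleftrightarrow>
     a \<rightarrow> b \<and> a \<notin> set p \<and> (\<forall>c\<in>set p. \<not> a \<rightarrow> c) \<and> induced_path G (b # p)"
  (is "?L \<longleftrightarrow> ?R")
proof
  assume L: ?L
  have "\<not> a \<rightarrow> c" if "c \<in> set p" for c
  proof
    assume "a \<rightarrow> c"
    obtain i where i: "i < length p" "c = p ! i" using \<open>c \<in> set p\<close> by (auto simp: in_set_conv_nth)
    then have "(a # b # p) ! 0 \<rightarrow> (a # b # p) ! Suc (Suc i)" using \<open>a \<rightarrow> c\<close> by simp
    moreover have "0 < length (a # b # p)" "Suc (Suc i) < length (a # b # p)" using i by auto
    ultimately show False using L unfolding induced_path_def by blast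
  qed
  moreover have "j = Suc i \<or> i = Suc j"
    if "i < length (b # p)" "j < length (b # p)" "(b # p) ! i \<rightarrow> (b # p) ! j" for i j
  proof -
    have "Suc i < length (a # b # p)" "Suc j < length (a # b # p)"
      "(a # b # p) ! Suc i \<rightarrow> (a # b # p) ! Suc j"
      using that by auto
    then have "Suc j = Suc (Suc i) \<or> Suc i = Suc (Suc j)"
      using L unfolding induced_path_def by blast
    then show ?thesis by simp
  qed
  ultimately show ?R
    using L by (auto simp: induced_path_def vpath_def vwalk_Cons_iff)
next
  assume R: ?R
  have *: "j = Suc 0" if "j < length (a # b # p)" "a \<rightarrow> (a # b # p) ! j" for j
    using R that adj_not_same by (auto simp: nth_Cons split: nat.splits)
  have "j = Suc i \<or> i = Suc j"
    if "i < length (a # b # p)" "j < length (a # b # p)"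
      "(a # b # p) ! i \<rightarrow> (a # b # p) ! j" for i j
  proof (cases i)
    case 0
    then show ?thesis using * that by simp
  next
    case (Suc i')
    show ?thesis
    proof (cases j)
      case 0
      then show ?thesis using *[of i] that adj_commute by auto
    next
      case (Suc j')
      then show ?thesis
        using R that \<open>i = Suc i'\<close> unfolding induced_path_def by auto
    qed
  qed
  moreover have "a \<noteq> b" using R adj_not_same by blast
  ultimately show ?L
    using R by (auto simp: induced_path_def vpath_def vwalk_Cons_iff intro: adj_in_verts)
qed

lemma induced_path_suffix: "induced_path G (p @ q) \<Longrightarrow> q \<noteq> [] \<Longrightarrow> induced_path G q"
proof (induction p)
  case (Cons a p)
  then show ?case by (cases "p @ q") auto
qed simp

lemma induced_path_vwalk: "induced_path G p \<Longrightarrow> vwalk p G"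
  by (simp add: induced_path_def vpath_def)

text \<open>Induction on the walk. When \<open>a\<close> is put in front of an induced path, either
  \<open>a\<close> already lies on it and the part before \<open>a\<close> is dropped, or the path
  is entered at the last neighbor of \<open>a\<close>, so that no chord from \<open>a\<close>
  remains.\<close>

lemma vwalk_contains_induced_path:
  assumes "vwalk W G"
  obtains p where "induced_path G p" "hd p = hd W" "last p = last W" "set p \<subseteq> set W"
    "length p \<le> length W"
  using assms
proof (induction W arbitrary: thesis rule: list.induct)
  case (Cons a W)
  show ?case
  proof (cases "W = []")
    case True
    then show ?thesis using Cons.prems(1)[of "[a]"] Cons.prems(2) by (simp add: vwalk_Cons_iff)
  next
    case False
    then have W: "vwalk W G" "a \<rightarrow> hd W" using Cons.prems(2) by (auto simp: vwalk_Cons_iff)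
    obtain p where p: "induced_path G p" "hd p = hd W" "last p = last W" "set p \<subseteq> set W"
      "length p \<le> length W"
      using Cons.IH W(1) by blast
    have "p \<noteq> []" using p(1) by auto
    show ?thesis
    proof (cases "a \<in> set p")
      case True
      then obtain ys zs where split: "p = ys @ a # zs" by (meson split_list)
      then have "induced_path G (a # zs)" using p(1) induced_path_suffix by blast
      then show ?thesis
        using Cons.prems(1)[of "a # zs"] p split False by auto
    next
      case notin: False
      have "\<exists>b\<in>set p. a \<rightarrow> b" using W(2) p(2) \<open>p \<noteq> []\<close> by (metis hd_in_set)
      then obtain ys b zs where split: "p = ys @ b # zs" and b: "a \<rightarrow> b" "\<forall>z\<in>set zs. \<not> a \<rightarrow> z"
        using split_list_last_prop[of p "\<lambda>b. a \<rightarrow> b"] by blast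
      then have "induced_path G (b # zs)" using p(1) induced_path_suffix by blast
      then have "induced_path G (a # b # zs)" using b notin split by auto
      then show ?thesis
        using Cons.prems(1)[of "a # b # zs"] p split False by auto
    qed
  qed
qed simp

text \<open>\<open>shortest_path\<close> compares with paths only; shrinking a walk to an induced
  path extends the comparison to walks, which can be cut and glued freely.\<close>

lemma shortest_path_le:
  assumes "shortest_path G p" "vwalk q G" "hd q = hd p" "last q = last p"
  shows "length p \<le> length q"
proof -
  obtain r where r: "induced_path G r" "hd r = hd q" "last r = last q" "length r \<le> length q"
    using vwalk_contains_induced_path[OF assms(2)] by metis
  then have "vpath r G" by (simp add: induced_path_def)
  then have "length p - 1 \<le> length r - 1" "r \<noteq> []"
    using assms r by (auto simp: shortest_path_def vpath_def)
  then have "length p \<le> length r" by (cases r) auto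
  then show ?thesis using r by simp
qed

lemma distance_hereditary_length_eq:
  assumes "distance_hereditary G" "induced_path G p" "induced_path G q"
    "hd p = hd q" "last p = last q"
  shows "length p = length q"
proof (rule antisym)
  have "shortest_path G p" "shortest_path G q"
    using assms by (auto simp: distance_hereditary_def)
  then show "length p \<le> length q" "length q \<le> length p"
    using assms by (auto intro: shortest_path_le induced_path_vwalk)
qed

section \<open>Toll walks and the transit function\<close>

lemma toll_walk_rev:
  assumes "toll_walk G W"
  shows "toll_walk G (rev W)"
proof -
  have "W \<noteq> []" "2 \<le> length W" using assms by (auto simp: toll_walk_def)
  then have "rev W ! 1 = W ! (length W - 2)" "rev W ! (length W - 2) = W ! 1"
    by (auto simp: rev_nth numeral_2_eq_2 Suc_diff_Suc)
  then show ?thesis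
    using assms \<open>W \<noteq> []\<close> by (auto simp: toll_walk_def vwalk_rev hd_rev last_rev)
qed

lemma toll_transit_commute: "toll_transit G u v = toll_transit G v u"
proof -
  have "toll_transit G u v \<subseteq> toll_transit G v u" for u v
  proof
    fix w assume w: "w \<in> toll_transit G u v"
    show "w \<in> toll_transit G v u"
    proof (cases "u = v")
      case False
      then obtain W where W: "toll_walk G W" "hd W = u" "last W = v" "w \<in> set W"
        using w by (auto simp: toll_transit_def)
      have "toll_walk G (rev W)" "hd (rev W) = v" "last (rev W) = u" "w \<in> set (rev W)"
        using W toll_walk_rev by (auto simp: hd_rev last_rev)
      then show ?thesis using False unfolding toll_transit_def by auto
    qed (use w in simp)
  qed
  then show ?thesis by blast
qed

lemma induced_path_toll_walk:
  assumes "induced_path G p" "2 \<le> length p"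
  shows "toll_walk G p"
proof -
  have d: "distinct p" "p \<noteq> []" using assms by (auto simp: induced_path_def vpath_def)
  have adj: "p ! i \<rightarrow> p ! Suc i" if "Suc i < length p" for i
    using assms(1) that
  proof (induction p arbitrary: i)
    case (Cons a p)
    then show ?case by (cases p; cases i) auto
  qed simp
  have ind: "j = Suc i \<or> i = Suc j" if "i < length p" "j < length p" "p ! i \<rightarrow> p ! j" for i j
    using assms(1) that by (auto simp: induced_path_def)
  define n where "n = length p - 2"
  have n: "length p = Suc (Suc n)" using assms(2) by (simp add: n_def)
  have "hd p = p ! 0" "last p = p ! Suc n"
    using d n by (auto simp: hd_conv_nth last_conv_nth)
  moreover have "p ! 0 \<rightarrow> a \<longleftrightarrow> a = p ! 1" if "a \<in> set p" for a
  proof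
    assume "p ! 0 \<rightarrow> a"
    then show "a = p ! 1" using that ind[of 0] n by (fastforce simp: in_set_conv_nth)
  next
    assume "a = p ! 1"
    then show "p ! 0 \<rightarrow> a" using adj[of 0] n by simp
  qed
  moreover have "p ! Suc n \<rightarrow> a \<longleftrightarrow> a = p ! n" if "a \<in> set p" for a
  proof
    assume a: "p ! Suc n \<rightarrow> a"
    obtain j where j: "j < length p" "a = p ! j"
      using \<open>a \<in> set p\<close> by (auto simp: in_set_conv_nth)
    then show "a = p ! n" using ind[of "Suc n" j] a n by auto
  next
    assume "a = p ! n"
    then show "p ! Suc n \<rightarrow> a" using adj[of n] n adj_commute by simp
  qed
  moreover have "p ! 0 \<noteq> p ! Suc n" using d n by (simp add: nth_eq_iff_index_eq)
  ultimately show ?thesis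
    using assms n by (simp add: toll_walk_def induced_path_vwalk)
qed

lemma induced_path_subset_toll_transit:
  assumes "induced_path G p" "hd p = u" "last p = v" "u \<noteq> v"
  shows "set p \<subseteq> toll_transit G u v"
proof -
  have "2 \<le> length p" using assms by (cases p rule: list.exhaust) (auto simp: Suc_le_eq)
  then have "toll_walk G p" using assms induced_path_toll_walk by blast
  then show ?thesis using assms unfolding toll_transit_def by auto
qed

text \<open>Used with \<open>S = {u, v}\<close> to trap a toll walk between adjacent ends.\<close>

lemma vwalk_subset_closed:
  assumes "vwalk W G" "hd W \<in> S" "\<And>a b. a \<in> S \<Longrightarrow> b \<in> set W \<Longrightarrow> a \<rightarrow> b \<Longrightarrow> b \<in> S"
  shows "set W \<subseteq> S"
  using assms
proof (induction W rule: list.induct)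
  case (Cons a W)
  show ?case
  proof (cases "W = []")
    case False
    then have "vwalk W G" "a \<rightarrow> hd W" using Cons.prems(1) by (auto simp: vwalk_Cons_iff)
    moreover have "hd W \<in> S"
      using Cons.prems(2) Cons.prems(3)[of a "hd W"] False \<open>a \<rightarrow> hd W\<close> by simp
    ultimately have "set W \<subseteq> S" using Cons.IH Cons.prems(3) by (metis list.set_intros(2))
    then show ?thesis using Cons.prems(2) by simp
  qed (use Cons.prems(2) in simp)
qed simp

text \<open>On a toll walk between adjacent ends each end has the other as its only neighbor, so the
  walk never leaves the two. For nonadjacent distinct ends the interval is empty if there is no toll
  walk; otherwise it contains an induced path, whose second vertex is neither end.\<close>

lemma toll_transit_eq_doubleton_iff:
  assumes "u \<in> verts G" "v \<in> verts G"
  shows "toll_transit G u v = {u, v} \<longleftrightarrow> u = v \<or> u \<rightarrow> v"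
proof (cases "u = v")
  case False
  show ?thesis
  proof (cases "u \<rightarrow> v")
    case True
    have "induced_path G [u, v]" using True assms by simp
    then have "{u, v} \<subseteq> toll_transit G u v"
      using induced_path_subset_toll_transit[of "[u, v]" u v] False by simp
    moreover have "set W \<subseteq> {u, v}" if W: "toll_walk G W" "hd W = u" "last W = v" for W
    proof -
      have nbr: "\<forall>a\<in>set W. u \<rightarrow> a \<longleftrightarrow> a = W ! 1"
        "\<forall>a\<in>set W. v \<rightarrow> a \<longleftrightarrow> a = W ! (length W - 2)"
        and ne: "W \<noteq> []"
        using W by (auto simp: toll_walk_def)
      have "u \<in> set W" "v \<in> set W" using W(2,3) ne by auto
      then have "W ! 1 = v" "W ! (length W - 2) = u"
        using nbr True adj_commute by metis+
      then show ?thesis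
        using nbr W by (intro vwalk_subset_closed) (auto simp: toll_walk_def)
    qed
    ultimately show ?thesis using True False by (auto simp: toll_transit_def)
  next
    case nadj: False
    have "toll_transit G u v \<noteq> {u, v}"
    proof
      assume eq: "toll_transit G u v = {u, v}"
      then have "u \<in> toll_transit G u v" by simp
      then obtain W where "toll_walk G W" "hd W = u" "last W = v"
        using False by (auto simp: toll_transit_def)
      then obtain p where p: "induced_path G p" "hd p = u" "last p = v"
        using vwalk_contains_induced_path toll_walk_def by metis
      have sub: "set p \<subseteq> {u, v}" using induced_path_subset_toll_transit[OF p False] eq by simp
      obtain r where r: "p = u # r" using p by (cases p) auto
      then obtain b s where s: "p = u # b # s" using p False by (cases r) auto
      then have "u \<rightarrow> b" using p(1) by simp
      then show False using sub s nadj adj_not_same by auto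
    qed
    then show ?thesis using False nadj by simp
  qed
qed (simp add: toll_transit_def)

section \<open>Distance-hereditary graphs satisfy the axioms\<close>

text \<open>In a distance-hereditary graph the two walks contain induced paths \<open>y, x, \<dots>, u\<close> and
  \<open>x, y, \<dots>, u\<close>, so that each of \<open>x\<close> and \<open>y\<close> would be farther from \<open>u\<close> than the other.\<close>

lemma distance_hereditary_no_two_walks:
  assumes dh: "distance_hereditary G"
    and "vwalk W G" "hd W = y" "last W = u" "\<forall>a\<in>set W. y \<rightarrow> a \<longrightarrow> a = x"
    and "vwalk W' G" "hd W' = x" "last W' = u" "\<forall>a\<in>set W'. x \<rightarrow> a \<longrightarrow> a = y"
    and "x \<noteq> u" "y \<noteq> u"
  shows False
proof -
  have *: "\<exists>r. induced_path G (y # x # r) \<and> last (x # r) = u"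
    if W: "vwalk W G" "hd W = y" "last W = u" "\<forall>a\<in>set W. y \<rightarrow> a \<longrightarrow> a = x"
      and "y \<noteq> u"
    for W x y
  proof -
    obtain p where p: "induced_path G p" "hd p = y" "last p = u" "set p \<subseteq> set W"
      using vwalk_contains_induced_path[OF W(1)] W(2,3) by metis
    obtain r where r: "p = y # r" using p by (cases p) auto
    then obtain b s where s: "p = y # b # s" using p \<open>y \<noteq> u\<close> by (cases r) auto
    then have "b = x" using p W by simp
    then show ?thesis using p s by (intro exI[of _ s]) simp
  qed
  obtain r where r: "induced_path G (y # x # r)" "last (x # r) = u"
    using *[of W y x] assms by blast
  obtain s where s: "induced_path G (x # y # s)" "last (y # s) = u"
    using *[of W' x y] assms by blast
  have "length (y # x # r) = length (y # s)"
    using r s by (intro distance_hereditary_length_eq[OF dh]) auto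
  moreover have "length (x # y # s) = length (x # r)"
    using r s by (intro distance_hereditary_length_eq[OF dh]) auto
  ultimately show False by simp
qed

text \<open>If \<open>W'\<close> came to \<open>u\<close> or to a neighbor of \<open>u\<close>,
  cutting it there and appending \<open>u\<close> if necessary would give the second walk of the
  forbidden pair. Nonadjacency of \<open>x\<close> and \<open>u\<close> ensures that the appended
  \<open>u\<close> is no new neighbor of \<open>x\<close>.\<close>

lemma distance_hereditary_walks_apart:
  assumes dh: "distance_hereditary G"
    and W: "vwalk W G" "hd W = y" "last W = u" "\<forall>a\<in>set W. y \<rightarrow> a \<longrightarrow> a = x"
    and W': "vwalk W' G" "hd W' = x" "\<forall>a\<in>set W'. x \<rightarrow> a \<longrightarrow> a = y"
    and u: "x \<noteq> u" "y \<noteq> u" "\<not> x \<rightarrow> u"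
    and c: "c \<in> set W'"
  shows "c \<noteq> u \<and> \<not> u \<rightarrow> c"
proof (rule ccontr)
  assume neg: "\<not> (c \<noteq> u \<and> \<not> u \<rightarrow> c)"
  obtain A B where split: "W' = A @ c # B" using c by (meson split_list)
  define W2 where "W2 = A @ [c]"
  have "vwalk (W2 @ B) G" using W' split by (simp add: W2_def)
  then have 2: "vwalk W2 G" unfolding W2_def by (rule vwalkI_append_l[rotated]) simp
  have 3: "hd W2 = x" using W' split by (cases A) (auto simp: W2_def)
  have 4: "set W2 \<subseteq> set W'" "W2 \<noteq> []" "last W2 = c" using split by (auto simp: W2_def)
  show False
  proof (cases "c = u")
    case True
    show False
      using 2 3 4 W W' u True
      by (intro distance_hereditary_no_two_walks[OF dh W, of W2]) auto
  next
    case False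
    then have "c \<rightarrow> u" using neg adj_commute by blast
    then have "vwalk (W2 @ [u]) G"
      using 2 4 by (simp add: vwalk_append_iff vwalk_Cons_iff adj_in_verts)
    then show False
      using 3 4 W W' u
      by (intro distance_hereditary_no_two_walks[OF dh W, of "W2 @ [u]"]) auto
  qed
qed

text \<open>The start \<open>y\<close> of a toll walk has one neighbor on it, so a vertex of the
  walk adjacent to \<open>y\<close> must be that neighbor.\<close>

lemma toll_transit_adjacent_last:
  assumes "x \<in> toll_transit G y u" "y \<rightarrow> x" "y \<noteq> u"
  obtains W where "toll_walk G W" "hd W = y" "last W = u" "\<forall>a\<in>set W. y \<rightarrow> a \<longleftrightarrow> a = x"
    "x \<in> set W"
proof -
  obtain W where W: "toll_walk G W" "hd W = y" "last W = u" "x \<in> set W"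
    using assms by (auto simp: toll_transit_def)
  then have *: "\<forall>a\<in>set W. y \<rightarrow> a \<longleftrightarrow> a = W ! 1" by (auto simp: toll_walk_def)
  then have "x = W ! 1" using W assms(2) by blast
  then show thesis using that W * by blast
qed

lemma distance_hereditary_axiom_dh1:
  assumes dh: "distance_hereditary G"
  shows "axiom_dh1 (verts G) (toll_transit G)"
  unfolding axiom_dh1_def
proof (intro ballI impI, elim conjE)
  fix u x y v
  assume V: "u \<in> verts G" "x \<in> verts G" "y \<in> verts G" "v \<in> verts G"
    and xT: "x \<in> toll_transit G u y" and yT: "y \<in> toll_transit G x v"
    and xy: "toll_transit G x y = {x, y}" "x \<noteq> y"
    and ux: "toll_transit G u x \<noteq> {u, x}" and yv: "toll_transit G y v \<noteq> {y, v}"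
  have adj: "x \<rightarrow> y" "y \<rightarrow> x"
    using xy toll_transit_eq_doubleton_iff V adj_commute by blast+
  have nu: "u \<noteq> x" "\<not> u \<rightarrow> x" "\<not> x \<rightarrow> u" and nv: "v \<noteq> y" "\<not> y \<rightarrow> v"
    using ux yv toll_transit_eq_doubleton_iff V adj_commute by blast+
  have uy: "u \<noteq> y" using xT xy by (auto simp: toll_transit_def)
  have xv: "x \<noteq> v" using yT xy by (auto simp: toll_transit_def)
  obtain W where W: "toll_walk G W" "hd W = y" "last W = u" "\<forall>a\<in>set W. y \<rightarrow> a \<longleftrightarrow> a = x"
    "x \<in> set W"
    using toll_transit_adjacent_last[of x y u] xT toll_transit_commute adj uy by metis
  obtain W' where W': "toll_walk G W'" "hd W' = x" "last W' = v" "\<forall>a\<in>set W'. x \<rightarrow> a \<longleftrightarrow> a = y"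
    "y \<in> set W'"
    using toll_transit_adjacent_last[of y x v] yT adj xv by metis
  have vw: "vwalk W G" "vwalk W' G" using W W' by (auto simp: toll_walk_def)
  have apart_u: "\<forall>c\<in>set W'. c \<noteq> u \<and> \<not> u \<rightarrow> c"
    using W W' nu uy vw
    by (intro ballI distance_hereditary_walks_apart[OF dh, of W y u x W']) auto
  have apart_v: "\<forall>c\<in>set W. c \<noteq> v \<and> \<not> v \<rightarrow> c"
    using W W' nv xv vw
    by (intro ballI distance_hereditary_walks_apart[OF dh, of W' x v y W]) auto
  \<comment> \<open>The glued walk \<open>?U @ W'\<close> reads
    \<open>u, ..., x, y, x, y, ..., v\<close>. Repeated inner vertices are harmless in a toll walk;
    only the neighbors of \<open>u\<close> and \<open>v\<close> have to be checked.\<close>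
  let ?U = "rev W"
  have U: "toll_walk G ?U" "hd ?U = u" "last ?U = y"
    using W toll_walk_rev by (auto simp: hd_rev last_rev)
  have ne: "?U \<noteq> []" "W' \<noteq> []" and len: "2 \<le> length ?U" "2 \<le> length W'"
    using U W' by (auto simp: toll_walk_def)
  have "v \<in> set W'" using W' ne by auto
  have "vwalk (?U @ W') G"
    using U W' ne adj by (simp add: vwalk_append_iff toll_walk_def)
  moreover have "(?U @ W') ! 1 = ?U ! 1"
    using len by (simp add: nth_append)
  moreover have "(?U @ W') ! (length (?U @ W') - 2) = W' ! (length W' - 2)"
    using len by (auto simp: nth_append)
  moreover have "\<forall>a\<in>set ?U. u \<rightarrow> a \<longleftrightarrow> a = ?U ! 1"
    "\<forall>a\<in>set W'. v \<rightarrow> a \<longleftrightarrow> a = W' ! (length W' - 2)"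
    using U W' by (auto simp: toll_walk_def)
  moreover have "?U ! 1 \<in> set ?U" "W' ! (length W' - 2) \<in> set W'"
    using len by (auto intro!: nth_mem simp del: set_rev)
  moreover have "u \<noteq> v" using apart_u \<open>v \<in> set W'\<close> by blast
  moreover from calculation have "\<forall>a\<in>set W'. a \<noteq> ?U ! 1"
    "\<forall>a\<in>set ?U. a \<noteq> W' ! (length W' - 2)"
    using apart_u apart_v by auto
  ultimately have "toll_walk G (?U @ W')"
    using apart_u apart_v U W' ne len unfolding toll_walk_def
    by (simp add: ball_Un)
  then show "x \<in> toll_transit G u v"
    using U W' W ne \<open>u \<noteq> v\<close> unfolding toll_transit_def
    by (auto intro!: exI[of _ "?U @ W'"] simp: hd_append)
qed

text \<open>In a counterexample \<open>z\<close> is adjacent to the other four vertices. Comparison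
  with \<open>y, z, u\<close> and \<open>x, z, v\<close> forces the edges \<open>x u\<close> and
  \<open>y v\<close>; then \<open>u, x, y, v\<close> and \<open>u, z, v\<close> are induced paths of
  different lengths.\<close>

lemma distance_hereditary_axiom_dh:
  assumes dh: "distance_hereditary G"
  shows "axiom_dh (verts G) (toll_transit G)"
  unfolding axiom_dh_def
proof (intro ballI impI, elim conjE)
  fix u x y v z
  assume V: "u \<in> verts G" "x \<in> verts G" "y \<in> verts G" "v \<in> verts G" "z \<in> verts G"
    and d: "distinct [u, x, y, v, z]"
    and T: "{x, y, z} \<subseteq> toll_transit G u y \<inter> toll_transit G x v"
    and uv: "toll_transit G u v \<noteq> {u, v}" and xy: "toll_transit G x y = {x, y}"
    and uz: "toll_transit G u z = {u, z}" and vz: "toll_transit G v z = {v, z}"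
  show "toll_transit G x z \<noteq> {x, z} \<or> toll_transit G y z \<noteq> {y, z}"
  proof (rule ccontr)
    assume "\<not> ?thesis"
    then have adj: "x \<rightarrow> z" "y \<rightarrow> z" "u \<rightarrow> z" "v \<rightarrow> z" "x \<rightarrow> y"
      and nuv: "\<not> u \<rightarrow> v"
      using uv xy uz vz d V by (auto simp: toll_transit_eq_doubleton_iff)
    note adj' = adj[THEN iffD1[OF adj_commute]] adj
    \<comment> \<open>Stated for arbitrary vertices because it is applied a second time with
      \<open>x\<close> and \<open>y\<close> exchanged and \<open>v\<close> in place of
      \<open>u\<close>.\<close>
    have *: "x \<rightarrow> u"
      if xT: "x \<in> toll_transit G y u" and xy: "y \<rightarrow> x" and yz: "y \<rightarrow> z" and zu: "z \<rightarrow> u"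
        and ne: "x \<noteq> u" "y \<noteq> u" and nyu: "\<not> y \<rightarrow> u"
      for x y u
    proof -
      obtain W where W: "toll_walk G W" "hd W = y" "last W = u"
        "\<forall>a\<in>set W. y \<rightarrow> a \<longleftrightarrow> a = x" "x \<in> set W"
        using toll_transit_adjacent_last[of x y u] xT xy ne by metis
      obtain p where p: "induced_path G p" "hd p = y" "last p = u" "set p \<subseteq> set W"
        using vwalk_contains_induced_path[of W] W toll_walk_def by metis
      have "induced_path G [y, z, u]" using yz zu ne nyu by (simp add: adj_in_verts)
      then have "length p = length [y, z, u]"
        using p by (intro distance_hereditary_length_eq[OF dh]) auto
      then obtain b where "p = [y, b, u]" using p(2,3)
        by (auto simp: length_Suc_conv numeral_3_eq_3)
      then show ?thesis using p W by auto
    qed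
    have nonadj: "\<not> y \<rightarrow> u" "\<not> x \<rightarrow> v"
    proof -
      have "x \<in> toll_transit G u y" "y \<in> toll_transit G x v" "x \<notin> {u, y}" "y \<notin> {x, v}"
        using T d by auto
      then have "toll_transit G u y \<noteq> {u, y}" "toll_transit G x v \<noteq> {x, v}" by metis+
      then show "\<not> y \<rightarrow> u" "\<not> x \<rightarrow> v"
        using V toll_transit_eq_doubleton_iff adj_commute by blast+
    qed
    have "x \<rightarrow> u"
      using *[of x y u] T d adj' nonadj toll_transit_commute[of u y] by auto
    moreover have "y \<rightarrow> v"
      using *[of y x v] T d adj' nonadj by auto
    ultimately have "induced_path G [u, x, y, v]" "induced_path G [u, z, v]"
      using adj' nuv nonadj d V by (auto simp: adj_commute)
    then have "length [u, x, y, v] = length [u, z, v]"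
      by (intro distance_hereditary_length_eq[OF dh]) auto
    then show False by simp
  qed
qed

section \<open>The axioms imply distance-heredity\<close>

lemma axiom_dh1_no_two_induced_paths:
  assumes dh1: "axiom_dh1 (verts G) (toll_transit G)"
    and r: "induced_path G (y # x # r)" "r \<noteq> []" "last r = u"
    and s: "induced_path G (x # y # s)" "s \<noteq> []" "last s = u"
  shows False
proof -
  have V: "x \<in> verts G" "y \<in> verts G" "u \<in> verts G"
    using r s induced_path_vwalk[OF r(1)] by (auto simp: vwalk_def)
  have u: "u \<in> set r" "u \<in> set s" using r s last_in_set by metis+
  then have ne: "y \<noteq> u" "x \<noteq> u" "x \<noteq> y" "\<not> y \<rightarrow> u" "\<not> x \<rightarrow> u" "x \<rightarrow> y"
    using r(1) s(1) adj_not_same by auto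
  have "x \<in> toll_transit G u y"
    using induced_path_subset_toll_transit[OF r(1), of y u] r ne toll_transit_commute by auto
  moreover have "y \<in> toll_transit G x u"
    using induced_path_subset_toll_transit[OF s(1), of x u] s ne by auto
  \<comment> \<open>Axiom (dh1) with its vertex \<open>v\<close> chosen to be
    \<open>u\<close>.\<close>
  ultimately have "x \<in> toll_transit G u u"
    using dh1 V ne unfolding axiom_dh1_def
    by (metis toll_transit_eq_doubleton_iff adj_commute)
  then show False using ne by (simp add: toll_transit_def)
qed

text \<open>By \<open>min\<close>, \<open>x\<close> is neither on \<open>v # w # s\<close> nor
  adjacent to a vertex of \<open>s\<close>, as it would otherwise reach the end too soon. Were
  \<open>x\<close> not adjacent to \<open>w\<close> either, \<open>x, v, w, ...\<close> would be
  induced and form the forbidden pair with \<open>v, x, ...\<close>. Once \<open>x\<close> is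
  adjacent to \<open>w\<close>, the walk \<open>x # w # s\<close> and \<open>min\<close> settle the
  length.\<close>

lemma axiom_dh1_shortcut:
  assumes dh1: "axiom_dh1 (verts G) (toll_transit G)"
    and P: "induced_path G (v # x # r)" "r \<noteq> []"
    and min: "\<And>q. vwalk q G \<Longrightarrow> hd q = x \<Longrightarrow> last q = last r \<Longrightarrow> length (x # r) \<le> length q"
    and Q: "induced_path G (v # w # s)" "s \<noteq> []" "last s = last r"
      "length (v # w # s) \<le> length (x # r)"
  shows "x \<rightarrow> w \<and> length (v # w # s) = length (x # r)"
proof -
  have xv: "x \<rightarrow> v" using P adj_commute by auto
  then have "x \<in> verts G" "x \<noteq> v" using adj_in_verts adj_not_same by auto
  have suffix: "vwalk (c # B) G" "last (c # B) = last r"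
    "length (c # B) + length A = length (v # w # s)"
    if "v # w # s = A @ c # B" for A c B
  proof -
    show "vwalk (c # B) G"
      using Q(1) that induced_path_suffix induced_path_vwalk by (metis list.discI)
    show "last (c # B) = last r" using that Q(2,3) by (metis last_ConsR last_appendR list.discI)
    show "length (c # B) + length A = length (v # w # s)" by (simp add: that)
  qed
  have "x \<notin> set (v # w # s)"
  proof
    assume "x \<in> set (v # w # s)"
    then obtain A B where A: "v # w # s = A @ x # B" by (meson split_list)
    then obtain a A' where "A = a # A'" using \<open>x \<noteq> v\<close> by (cases A) auto
    then show False using suffix[OF A] min[of "x # B"] Q(4) by simp
  qed
  moreover have far: "\<not> x \<rightarrow> c" if c: "c \<in> set s" for c
  proof
    assume "x \<rightarrow> c"
    obtain A B where "s = A @ c # B" using c by (meson split_list)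
    then have A: "v # w # s = (v # w # A) @ c # B" by simp
    have "vwalk (x # c # B) G" using suffix[OF A] \<open>x \<rightarrow> c\<close> \<open>x \<in> verts G\<close>
      by (simp add: vwalk_Cons_iff[of x])
    then show False using suffix[OF A] min[of "x # c # B"] Q(4) by simp
  qed
  ultimately have "x \<rightarrow> w"
    using axiom_dh1_no_two_induced_paths[OF dh1, of v x r "last r" "w # s"] P Q xv by auto
  moreover have "vwalk (x # w # s) G"
    using \<open>x \<rightarrow> w\<close> induced_path_vwalk[of "w # s"] Q(1) \<open>x \<in> verts G\<close>
    by (simp add: vwalk_Cons_iff[of x])
  then have "length (x # r) \<le> length (x # w # s)" using Q by (intro min) auto
  ultimately show ?thesis using Q(4) by simp
qed

text \<open>The two-edge paths through \<open>w\<close>, and those along \<open>P\<close>, put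
  \<open>x\<close>, \<open>y\<close> and \<open>w\<close> into both toll intervals required by (dh),
  with \<open>w\<close> as its \<open>z\<close>.\<close>

lemma axiom_dh_no_gem:
  assumes dh: "axiom_dh (verts G) (toll_transit G)"
    and P: "induced_path G [v, y, x, u]"
    and w: "w \<rightarrow> v" "w \<rightarrow> y" "w \<rightarrow> x" "w \<rightarrow> u"
  shows False
proof -
  have V: "u \<in> verts G" "v \<in> verts G" "x \<in> verts G" "y \<in> verts G" "w \<in> verts G"
    using w adj_in_verts by auto
  have w': "v \<rightarrow> w" "y \<rightarrow> w" "x \<rightarrow> w" "u \<rightarrow> w" using w adj_commute by auto
  have adj: "v \<rightarrow> y" "y \<rightarrow> x" "x \<rightarrow> u" "y \<rightarrow> v" "x \<rightarrow> y" "u \<rightarrow> x"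
    "\<not> v \<rightarrow> x" "\<not> v \<rightarrow> u" "\<not> y \<rightarrow> u" "\<not> x \<rightarrow> v" "\<not> u \<rightarrow> v" "\<not> u \<rightarrow> y"
    using P by (auto simp: adj_commute)
  have d: "distinct [u, x, y, v, w]"
    using w w' adj adj_not_same by auto
  have "set [u, x, y] \<union> set [u, w, y] \<subseteq> toll_transit G u y"
    using V w w' adj d
    by (intro Un_least induced_path_subset_toll_transit) auto
  moreover have "set [x, y, v] \<union> set [x, w, v] \<subseteq> toll_transit G x v"
    using V w w' adj d
    by (intro Un_least induced_path_subset_toll_transit) auto
  ultimately have "{x, y, w} \<subseteq> toll_transit G u y \<inter> toll_transit G x v" by auto
  then show False
    using dh V d w' adj unfolding axiom_dh_def
    by (metis toll_transit_eq_doubleton_iff distinct_length_2_or_more)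
qed

text \<open>Induction on the length of an induced path \<open>v, x, p, q, \<dots>, u\<close>. Against a shorter
  geodesic \<open>v, w, \<dots>, u\<close>, axiom (dh1) forces \<open>w\<close> to be adjacent to \<open>x\<close> and the geodesic to be
  shorter by exactly one. If \<open>w\<close> is adjacent to \<open>q\<close>, there is a gem or a house; otherwise
  \<open>w, p, q, \<dots>, u\<close> or \<open>w, x, p, q, \<dots>, u\<close> is an induced path that is too long.\<close>

lemma axioms_imp_distance_hereditary:
  assumes dh: "axiom_dh (verts G) (toll_transit G)"
    and dh1: "axiom_dh1 (verts G) (toll_transit G)"
  shows "distance_hereditary G"
  unfolding distance_hereditary_def
proof (intro allI impI)
  fix P assume "induced_path G P"
  then show "shortest_path G P"
  proof (induction P rule: length_induct)
    case (1 P)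
    show ?case
    proof (rule ccontr)
      assume "\<not> shortest_path G P"
      then obtain W where W: "vwalk W G" "hd W = hd P" "last W = last P" "length W < length P"
        using 1 by (fastforce simp: shortest_path_def induced_path_def vpath_def not_le)
      \<comment> \<open>An induced path inside a shortest walk with the ends of \<open>P\<close> is
        a geodesic \<open>Q\<close> that is also induced.\<close>
      define C where "C W \<longleftrightarrow> vwalk W G \<and> hd W = hd P \<and> last W = last P" for W
      have "C W" using W C_def by auto
      then obtain W0 where W0: "C W0" "\<forall>q. C q \<longrightarrow> length W0 \<le> length q"
        using ex_has_least_nat[of C W length] by blast
      obtain Q where Q: "induced_path G Q" "hd Q = hd P" "last Q = last P"
        "length Q \<le> length W0"
        using vwalk_contains_induced_path W0(1) unfolding C_def by metis
      have short: "length Q < length P"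
        using Q W W0 \<open>C W\<close> by (meson le_less_trans)
      have Qmin: "length Q \<le> length q" if "vwalk q G" "hd q = hd P" "last q = last P" for q
        using Q W0 that C_def le_trans by blast
      have IH: "length p \<le> length q"
        if "induced_path G p" "length p < length P" "vwalk q G" "hd q = hd p" "last q = last p"
        for p q
        using 1 that shortest_path_le by blast
      \<comment> \<open>The first vertices are named one by one. The ends of \<open>P\<close> are
        distinct and nonadjacent, so \<open>Q\<close> has at least three vertices.\<close>
      obtain v Q1 where Q1: "Q = v # Q1" using Q(1) by (cases Q) auto
      obtain P1 where P1: "P = v # P1" using 1 Q Q1 by (cases P) auto
      obtain x P2 where P2: "P = v # x # P2" using P1 short Q1 by (cases P1) auto
      have "last P \<noteq> v" using 1(2) P2 adj_not_same by (cases P2) auto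
      then obtain w Q2 where Q2: "Q = v # w # Q2" using Q(3) Q1 by (cases Q1) auto
      obtain p P3 where P3: "P = v # x # p # P3" using P2 short Q2 by (cases P2) auto
      have "\<not> v \<rightarrow> last P" using 1(2) P3 last_in_set[of "p # P3"] by auto
      then have "Q2 \<noteq> []" using Q Q2 by auto
      have iP: "induced_path G P" by (fact 1)
      \<comment> \<open>The tail of \<open>P\<close> is a shorter induced path, hence a geodesic by
        induction, as the shortcut lemma requires.\<close>
      have key: "x \<rightarrow> w \<and> length (v # w # Q2) = length (x # p # P3)"
      proof (rule axiom_dh1_shortcut[OF dh1])
        show "length (x # p # P3) \<le> length q"
          if "vwalk q G" "hd q = x" "last q = last (p # P3)" for q
          using IH[of "x # p # P3" q] iP P3 that by simp
      qed (use iP P3 Q Q2 \<open>Q2 \<noteq> []\<close> short in auto)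
      then obtain q R where R: "P = v # x # p # q # R"
        using P3 \<open>Q2 \<noteq> []\<close> by (cases P3) auto
      have len: "length (v # w # Q2) = length (x # p # q # R)" using key P3 R by simp
      have adj: "v \<rightarrow> w" "w \<rightarrow> v" "x \<rightarrow> w" "w \<rightarrow> x" using key Q(1) Q2 adj_commute by auto
      then have V: "v \<in> verts G" "w \<in> verts G" using adj_in_verts by auto
      have iP': "v \<rightarrow> x" "x \<rightarrow> p" "p \<rightarrow> q" "\<not> v \<rightarrow> p" "\<not> v \<rightarrow> q" "\<not> x \<rightarrow> q" "v \<noteq> p" "v \<noteq> q" "x \<noteq> q"
        "x \<rightarrow> v" "p \<rightarrow> x" "q \<rightarrow> p" "\<not> p \<rightarrow> v" "\<not> q \<rightarrow> v" "\<not> q \<rightarrow> x" "q \<in> verts G"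
        using iP R adj_commute by (auto intro: adj_in_verts)
      have wq: "w \<noteq> q" "w \<noteq> p" using adj iP' by auto
      have lastQ2: "last Q2 = last (q # R)" using Q(3) Q2 \<open>Q2 \<noteq> []\<close> R by simp
      show False
      proof (cases "w \<rightarrow> q")
        case True
        show False
        proof (cases "w \<rightarrow> p")
          case p: True
          have "induced_path G [v, x, p, q]" using iP' by simp
          then show False using axiom_dh_no_gem[OF dh] True p adj by blast
        next
          case False
          \<comment> \<open>A house: the square \<open>x, p, q, w\<close> with roof
            \<open>v\<close>. Its two sides, seen from the floor edge \<open>p q\<close>, form the
            forbidden pair ending in \<open>v\<close>.\<close>
          have "induced_path G [q, p, x, v]" using iP' V by auto
          moreover have "induced_path G [p, q, w, v]"
            using iP' V adj True False wq adj_commute by auto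
          ultimately show False
            using axiom_dh1_no_two_induced_paths[OF dh1, of q p "[x, v]" v "[w, v]"] by simp
        qed
      next
        case False
        \<comment> \<open>If \<open>c\<close> were equal or adjacent to \<open>w\<close>, going from
          \<open>v\<close> to \<open>w\<close> and on along \<open>P\<close> from \<open>c\<close>
          would beat \<open>Q\<close>, which has \<open>length R + 3\<close> vertices.\<close>
        have far: "w \<noteq> c \<and> \<not> w \<rightarrow> c" if c: "c \<in> set R" for c
        proof -
          obtain A B where split: "R = A @ c # B" using c by (meson split_list)
          have "vwalk P G" using iP induced_path_vwalk by blast
          then have c: "vwalk (c # B) G"
            using R split vwalkI_append_r[of "c # B" "v # x # p # q # A" G]
            by (simp del: vwalk_arcs_Cons)
          have lastc: "last (c # B) = last P" using R split by simp
          have "w \<noteq> c"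
          proof
            assume "w = c"
            then have "vwalk (v # c # B) G" using c adj V by (simp add: vwalk_Cons_iff[of v])
            then have "length Q \<le> length (v # c # B)"
              using lastc R by (intro Qmin) auto
            then show False using len Q2 split by simp
          qed
          moreover have "\<not> w \<rightarrow> c"
          proof
            assume "w \<rightarrow> c"
            then have "vwalk (v # w # c # B) G" using c adj V
              by (simp add: vwalk_Cons_iff[of v] vwalk_Cons_iff[of w])
            then have "length Q \<le> length (v # w # c # B)"
              using lastc R by (intro Qmin) auto
            then show False using len Q2 split by simp
          qed
          ultimately show ?thesis by simp
        qed
        have Q': "induced_path G (w # Q2)" using Q(1) Q2 by simp
        show False
        proof (cases "w \<rightarrow> p")
          case True
          \<comment> \<open>One vertex fewer than \<open>P\<close>, hence a geodesic by induction;
            yet \<open>w # Q2\<close> has the same ends and one vertex fewer still.\<close>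
          have "induced_path G (w # p # q # R)"
            using iP R True False far wq by auto
          then have "length (w # p # q # R) \<le> length (w # Q2)"
            using IH[of "w # p # q # R" "w # Q2"] induced_path_vwalk[OF Q'] lastQ2 R \<open>Q2 \<noteq> []\<close>
            by simp
          then show False using len by simp
        next
          case np: False
          \<comment> \<open>This path is as long as \<open>P\<close>, out of reach of the induction
            hypothesis. The shortcut lemma, now started at \<open>w\<close>, demands that
            \<open>w # Q2\<close> have as many vertices as \<open>x # p # q # R\<close>, but it has
            one fewer.\<close>
          have wP: "induced_path G (w # x # p # q # R)"
            using iP R np False far wq adj by auto
          obtain w' Q3 where Q3: "Q2 = w' # Q3" using \<open>Q2 \<noteq> []\<close> by (cases Q2) auto
          have "w \<noteq> last (q # R) \<and> \<not> w \<rightarrow> last (q # R)"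
            using far wq False last_in_set[of "q # R"] by (auto simp del: last.simps)
          then have "Q3 \<noteq> []" using lastQ2 Q3 Q' by auto
          have "length (w # w' # Q3) = length (x # p # q # R)"
          proof (rule conjunct2[OF axiom_dh1_shortcut[OF dh1 wP]])
            show "length (x # p # q # R) \<le> length r"
              if "vwalk r G" "hd r = x" "last r = last (p # q # R)" for r
              using IH[of "x # p # q # R" r] iP R that by simp
          qed (use Q' Q3 \<open>Q3 \<noteq> []\<close> lastQ2 len in auto)
          then show False using len Q3 by simp
        qed
      qed
    qed
  qed
qed

end

theorem theorem13:
  fixes G :: "('a, 'b) pre_digraph"
  assumes "graph G"
  shows "axiom_dh (verts G) (toll_transit G) \<and> axiom_dh1 (verts G) (toll_transit G)
    \<longleftrightarrow> distance_hereditary G"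
proof -
  interpret graph G by fact
  show ?thesis
    using axioms_imp_distance_hereditary distance_hereditary_axiom_dh
      distance_hereditary_axiom_dh1 by blast
qed

end
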